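(* Let $\alpha>0$. Let $\mathcal{S}_S$ be the collection of all subsets of $\mathbb{C}$ that contain a set of stable sampling for $\mathcal{F}_\alpha(\mathbb{C})$, let $\mathcal{S}_L$ be the collection of all Liouville sets for $\mathcal{F}_\alpha(\mathbb{C})$, and let $\mathcal{S}_U$ be the collection of all uniqueness sets for $\mathcal{F}_\alpha(\mathbb{C})$. Then $$\mathcal{S}_S\subsetneq\mathcal{S}_L\subsetneq\mathcal{S}_U.$$
   Context: For $\alpha>0$, $\mathcal{F}_\alpha(\mathbb{C})$ is the Fock space of entire functions $F:\mathbb{C}\to\mathbb{C}$ with $\|F\|_{\mathcal{F}_\alpha(\mathbb{C})}^2=\frac{\alpha}{\pi}\int_{\mathbb{C}}|F(z)|^2e^{-\alpha|z|^2}\,dA(z)<\infty$, where $dA$ is Lebesgue area measure. A discrete set $\Gamma\subseteq\mathbb{C}$ is a set of stable sampling for $\mathcal{F}_\alpha(\mathbb{C})$ if there are constants $A,B>0$ such that $A\|F\|_{\mathcal{F}_\alpha(\mathbb{C})}^2\le\sum_{\gamma\in\Gamma}e^{-\alpha|\gamma|^2}|F(\gamma)|^2\le B\|F\|_{\mathcal{F}_\alpha(\mathbb{C})}^2$ for all $F\in\mathcal{F}_\alpha(\mathbb{C})$. A set $\Lambda\subseteq\mathbb{C}$ is a Liouville set for $\mathcal{F}_\alpha(\mathbb{C})$ if every $F\in\mathcal{F}_\alpha(\mathbb{C})$ that is bounded on $\Lambda$ is a constant function. A set $\Lambda\subseteq\mathbb{C}$ is a uniqueness set for $\mathcal{F}_\alpha(\mathbb{C})$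 if the only function in $\mathcal{F}_\alpha(\mathbb{C})$ vanishing on $\Lambda$ is the zero function. *)

theory Defs
  imports "HOL-Analysis.Analysis"
begin

definition fock_weight :: "real \<Rightarrow> complex \<Rightarrow> real" where
  "fock_weight \<alpha> z = exp (- \<alpha> * (cmod z)\<^sup>2)"

(* lborel on complex is area measure. A holomorphic function is continuous, so
   Bochner integrability of the nonnegative integrand means exactly that its integral is finite. *)
definition fock_space :: "real \<Rightarrow> (complex \<Rightarrow> complex) set" where
  "fock_space \<alpha> =
     {F. F holomorphic_on UNIV \<and> integrable lborel (\<lambda>z. (cmod (F z))\<^sup>2 * fock_weight \<alpha> z)}"

definition fock_norm :: "real \<Rightarrow> (complex \<Rightarrow> complex) \<Rightarrow> real" where
  "fock_norm \<alpha> F = sqrt (\<alpha> / pi * (LINT z|lborel. (cmod (F z))\<^sup>2 * fock_weight \<alpha> z))"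

(* The notion of discreteness is the topological one: each point of \<Gamma> is isolated in \<Gamma>. The upper
   bound for F = 1 already excludes accumulation points anywhere in the plane. Summability, required
   because infsum is 0 on non-summable families, is the finiteness implicit in the upper bound. *)
definition stable_sampling :: "real \<Rightarrow> complex set \<Rightarrow> bool" where
  "stable_sampling \<alpha> \<Gamma> \<longleftrightarrow> discrete \<Gamma> \<and>
     (\<exists>A>0. \<exists>B>0. \<forall>F\<in>fock_space \<alpha>.
        (\<lambda>\<gamma>. fock_weight \<alpha> \<gamma> * (cmod (F \<gamma>))\<^sup>2) summable_on \<Gamma> \<and>
        A * (fock_norm \<alpha> F)\<^sup>2 \<le> (\<Sum>\<^sub>\<infinity>\<gamma>\<in>\<Gamma>. fock_weight \<alpha> \<gamma> * (cmod (F \<gamma>))\<^sup>2) \<and>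
        (\<Sum>\<^sub>\<infinity>\<gamma>\<in>\<Gamma>. fock_weight \<alpha> \<gamma> * (cmod (F \<gamma>))\<^sup>2) \<le> B * (fock_norm \<alpha> F)\<^sup>2)"

definition liouville_set :: "real \<Rightarrow> complex set \<Rightarrow> bool" where
  "liouville_set \<alpha> \<Lambda> \<longleftrightarrow> (\<forall>F\<in>fock_space \<alpha>. bounded (F ` \<Lambda>) \<longrightarrow> F constant_on UNIV)"

definition uniqueness_set :: "real \<Rightarrow> complex set \<Rightarrow> bool" where
  "uniqueness_set \<alpha> \<Lambda> \<longleftrightarrow> (\<forall>F\<in>fock_space \<alpha>. (\<forall>z\<in>\<Lambda>. F z = 0) \<longrightarrow> (\<forall>z. F z = 0))"

definition sampling_supersets :: "real \<Rightarrow> complex set set" where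
  "sampling_supersets \<alpha> = {\<Lambda>. \<exists>\<Gamma>\<subseteq>\<Lambda>. stable_sampling \<alpha> \<Gamma>}"

definition liouville_sets :: "real \<Rightarrow> complex set set" where
  "liouville_sets \<alpha> = {\<Lambda>. liouville_set \<alpha> \<Lambda>}"

definition uniqueness_sets :: "real \<Rightarrow> complex set set" where
  "uniqueness_sets \<alpha> = {\<Lambda>. uniqueness_set \<alpha> \<Lambda>}"

end

theory Submission
  imports Defs "HOL-Complex_Analysis.Complex_Analysis" "HOL-Probability.Distributions"
    "HOL-Real_Asymp.Real_Asymp"
begin

text \<open>
  The hard inclusion is that a set \<open>\<Gamma>\<close> of stable sampling is a Liouville set. Let \<open>F\<close> lie in the
  Fock space with \<open>\<bar>F\<bar> \<le> M\<close> on \<open>\<Gamma>\<close>. If every power \<open>F^n\<close> were in the space, the lower sampling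
  inequality would bound the norm of \<open>F^n\<close> by a constant times \<open>M^n\<close>, point evaluation would turn
  this into \<open>\<bar>F w\<bar>^n \<le> C w * M^n\<close>, and \<open>n\<close>-th roots would give \<open>\<bar>F\<bar> \<le> M\<close>, so that the
  theorem of Liouville applies. The powers belong to the space as soon as \<open>F\<close> is known to grow strictly
  more slowly than a general element: \<open>\<bar>F z\<bar>\<^sup>2 \<le> C * exp (t * \<bar>z\<bar>\<^sup>2)\<close> with \<open>t < \<alpha> / 2\<close> puts \<open>F\<^sup>2\<close> in
  the space, and \<open>F\<^sup>2\<close> is again bounded on \<open>\<Gamma>\<close>, so squaring can be repeated.

  The gain in growth comes from multiplication by \<open>z\<close>. If \<open>z^n * F\<close> is in the space for all \<open>n\<close>, the
  sampling inequalities bound \<open>\<bar>w^n * F w\<bar>\<^sup>2 * exp (- \<alpha> * \<bar>w\<bar>\<^sup>2)\<close> by a constant times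
  \<open>M\<^sup>2 * (\<Sum>\<gamma>. \<bar>\<gamma>\<bar>^(2 * n) * exp (- \<alpha> * \<bar>\<gamma>\<bar>\<^sup>2))\<close>, and an exponential generating series in \<open>n\<close> yields
  the smaller exponent (\<open>bounded_on_samples_growth\<close>).

  What remains is to see that \<open>z * F\<close> is in the space whenever its samples are square summable
  (\<open>mult_id_in_fock_space\<close>). The Weyl translations
  \<open>T\<^sub>h F z = exp (\<alpha> * cnj h * z) * F (z - h)\<close> act on the space, and the derivative of \<open>T\<^sub>h F\<close> at
  \<open>h = 0\<close> along the real and the imaginary axis combines to a multiple of \<open>z * F\<close>. The lower sampling
  inequality bounds \<open>T\<^sub>h F - F\<close> by its samples. Up to a unimodular factor \<open>u\<close>, the sample of \<open>T\<^sub>h F\<close>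
  at \<open>\<gamma>\<close>, weighted by \<open>exp (- \<alpha> * \<bar>\<gamma>\<bar>\<^sup>2 / 2)\<close>, is the value at \<open>- h\<close> of an entire function \<open>\<Phi>\<close> whose
  value at 0 is the weighted sample of \<open>F\<close>. The change of
  phase \<open>u - 1\<close> costs at most \<open>2 * \<alpha> * \<bar>h\<bar> * \<bar>\<gamma>\<bar>\<close>, which is where the samples of \<open>z * F\<close> enter;
  the increment of \<open>\<Phi>\<close> is controlled by the Schwarz lemma applied to the whole family at once, since the
  upper sampling inequality for the translates of \<open>F\<close> bounds that family in \<open>\<ell>\<^sup>2\<close>. So the
  difference quotients are bounded in the space and the lemma of Fatou finishes the argument.

  A union of circles whose radii have growing gaps is a Liouville set by the maximum principle,
  but a sampling set cannot leave arbitrarily large discs free (\<open>relatively_dense\<close>). The unit disc is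
  a uniqueness set on which the identity is bounded. A Liouville set is nonempty, since otherwise
  the identity would be a counterexample, and a constant vanishing somewhere is zero.
\<close>

section \<open>Gaussian integrals and membership in the Fock space\<close>

lemma fock_weight_pos: "0 < fock_weight \<alpha> z"
  by (simp add: fock_weight_def)

lemma fock_weight_measurable [measurable]: "fock_weight \<alpha> \<in> borel_measurable borel"
  unfolding fock_weight_def by measurable

lemma entire_borel_measurable: "F holomorphic_on UNIV \<Longrightarrow> F \<in> borel_measurable borel"
  by (intro borel_measurable_continuous_onI holomorphic_on_imp_continuous_on)

lemma integrable_gaussian_real:
  fixes t :: real
  assumes "t > 0"
  shows "integrable lborel (\<lambda>x. exp (- t * x\<^sup>2))"
proof -
  define s where "s = sqrt (1 / (2 * t))"
  have s: "s > 0" and s2: "2 * s\<^sup>2 = 1 / t"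
    using assms by (auto simp: s_def)
  have "integrable lborel (\<lambda>x. sqrt (2 * pi * s\<^sup>2) * normal_density 0 s x)"
    using s by (intro integrable_mult_right integrable_normal_moment[of s 0 0, simplified]) auto
  moreover have "sqrt (2 * pi * s\<^sup>2) * normal_density 0 s x = exp (- t * x\<^sup>2)" for x
    using s assms by (simp add: normal_density_def s2)
  ultimately show ?thesis by simp
qed

lemma integrable_gaussian_complex:
  fixes t :: real
  assumes "t > 0"
  shows "integrable lborel (\<lambda>z::complex. exp (- t * (cmod z)\<^sup>2))"
proof (rule integrableI_bounded)
  let ?g = "\<lambda>x. exp (- t * x\<^sup>2)"
  have split: "ennreal (norm (exp (- t * (cmod z)\<^sup>2))) = (\<Prod>b\<in>Basis. ennreal (?g (z \<bullet> b)))" for z :: complex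
    by (simp add: Basis_complex_def inner_complex_def cmod_power2 exp_add[symmetric]
        ennreal_mult[symmetric] algebra_simps)
  have fin: "(\<integral>\<^sup>+ x. ennreal (?g x) \<partial>lborel) < \<infinity>"
    using integrable_gaussian_real[OF assms] by (simp add: integrable_iff_bounded)
  have "(\<integral>\<^sup>+ z. ennreal (norm (exp (- t * (cmod z)\<^sup>2))) \<partial>(lborel::complex measure))
      = (\<Prod>b\<in>(Basis::complex set). (\<integral>\<^sup>+ x. ennreal (?g x) \<partial>lborel))"
    unfolding split by (rule nn_integral_lborel_prod) auto
  also have "\<dots> < \<infinity>"
    using fin by (simp add: Basis_complex_def ennreal_mult_less_top less_top)
  finally show "(\<integral>\<^sup>+ z. ennreal (norm (exp (- t * (cmod z)\<^sup>2))) \<partial>(lborel::complex measure)) < \<infinity>" .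
qed measurable

text \<open>The squared norm without the factor \<open>\<alpha> / pi\<close>, which can be absorbed in the sampling constants.\<close>

definition fock_energy :: "real \<Rightarrow> (complex \<Rightarrow> complex) \<Rightarrow> real" where
  "fock_energy \<alpha> F = (LINT z|lborel. (cmod (F z))\<^sup>2 * fock_weight \<alpha> z)"

lemma fock_energy_nonneg: "0 \<le> fock_energy \<alpha> F"
  unfolding fock_energy_def
  by (intro integral_nonneg_AE AE_I2) (simp add: fock_weight_def)

lemma fock_norm_sq:
  assumes "\<alpha> > 0"
  shows "(fock_norm \<alpha> F)\<^sup>2 = \<alpha> / pi * fock_energy \<alpha> F"
  using assms fock_energy_nonneg[of \<alpha> F]
  by (simp add: fock_norm_def fock_energy_def[symmetric])

lemma fock_space_holomorphic: "F \<in> fock_space \<alpha> \<Longrightarrow> F holomorphic_on UNIV"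
  by (simp add: fock_space_def)

lemma fock_space_growthI:
  assumes hol: "F holomorphic_on UNIV" and t: "t < \<alpha>"
    and bound: "\<And>z. (cmod (F z))\<^sup>2 \<le> C * exp (t * (cmod z)\<^sup>2)"
  shows "F \<in> fock_space \<alpha>"
proof -
  have [measurable]: "F \<in> borel_measurable borel" using entire_borel_measurable[OF hol] .
  have "integrable lborel (\<lambda>z::complex. C * exp (- (\<alpha> - t) * (cmod z)\<^sup>2))"
    using t by (intro integrable_mult_right integrable_gaussian_complex) auto
  moreover have "AE z in lborel. norm ((cmod (F z))\<^sup>2 * fock_weight \<alpha> z)
      \<le> norm (C * exp (- (\<alpha> - t) * (cmod z)\<^sup>2))"
  proof (rule AE_I2)
    fix z
    have "(cmod (F z))\<^sup>2 * fock_weight \<alpha> z \<le> C * exp (t * (cmod z)\<^sup>2) * fock_weight \<alpha> z"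
      using bound fock_weight_pos[of \<alpha> z] by (intro mult_right_mono) auto
    also have "\<dots> = C * exp (- (\<alpha> - t) * (cmod z)\<^sup>2)"
      by (simp add: fock_weight_def exp_add[symmetric] algebra_simps)
    finally show "norm ((cmod (F z))\<^sup>2 * fock_weight \<alpha> z) \<le> norm (C * exp (- (\<alpha> - t) * (cmod z)\<^sup>2))"
      using fock_weight_pos[of \<alpha> z] by simp
  qed
  ultimately have "integrable lborel (\<lambda>z. (cmod (F z))\<^sup>2 * fock_weight \<alpha> z)"
    by (elim Bochner_Integration.integrable_bound) measurable
  with hol show ?thesis by (simp add: fock_space_def)
qed

lemma one_in_fock_space:
  assumes "\<alpha> > 0"
  shows "(\<lambda>z. 1) \<in> fock_space \<alpha>"
  using assms by (intro fock_space_growthI[where t = 0 and C = 1]) auto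

lemma id_in_fock_space:
  assumes "\<alpha> > 0"
  shows "(\<lambda>z. z) \<in> fock_space \<alpha>"
proof (rule fock_space_growthI[where t = "\<alpha> / 2" and C = "2 / \<alpha>"])
  fix z :: complex
  have "\<alpha> / 2 * (cmod z)\<^sup>2 \<le> exp (\<alpha> / 2 * (cmod z)\<^sup>2)"
    using exp_ge_add_one_self[of "\<alpha> / 2 * (cmod z)\<^sup>2"] by linarith
  then show "(cmod z)\<^sup>2 \<le> 2 / \<alpha> * exp (\<alpha> / 2 * (cmod z)\<^sup>2)"
    using assms by (simp add: field_simps)
qed (use assms in auto)

lemma fock_energy_one_pos:
  assumes "\<alpha> > 0"
  shows "0 < fock_energy \<alpha> (\<lambda>z. 1)"
proof -
  have int: "integrable lborel (fock_weight \<alpha>)"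
    using one_in_fock_space[OF assms] by (simp add: fock_space_def)
  have "fock_energy \<alpha> (\<lambda>z. 1) \<noteq> 0"
  proof
    assume "fock_energy \<alpha> (\<lambda>z. 1) = 0"
    then have "AE z in lborel. fock_weight \<alpha> z = 0"
      using int integral_nonneg_eq_0_iff_AE[of lborel "fock_weight \<alpha>"]
      by (simp add: fock_energy_def fock_weight_pos less_imp_le)
    then have "AE z::complex in lborel. False"
      by (rule AE_mp) (auto intro!: AE_I2 simp: fock_weight_def)
    then show False
      using AE_iff_measurable[of UNIV lborel "\<lambda>_::complex. False"] by simp
  qed
  then show ?thesis
    using fock_energy_nonneg[of \<alpha> "\<lambda>z. 1"] by linarith
qed

section \<open>Weyl translations\<close>

text \<open>Multiplied by \<open>exp (- \<alpha> * \<bar>h\<bar>\<^sup>2 / 2)\<close> this is the unitary Weyl translation. Without that factor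
  the samples of a translate are exactly unimodular multiples of values of the recentred functions
  introduced below.\<close>

definition twisted_shift :: "real \<Rightarrow> complex \<Rightarrow> (complex \<Rightarrow> complex) \<Rightarrow> complex \<Rightarrow> complex" where
  "twisted_shift \<alpha> h F z = exp (of_real \<alpha> * cnj h * z) * F (z - h)"

text \<open>Completing the square in \<open>\<alpha> * \<bar>z\<bar>\<^sup>2 - 2 * \<alpha> * Re (cnj h * z)\<close> shows that the weighted modulus is
  merely translated.\<close>

lemma twisted_shift_weight:
  "(cmod (twisted_shift \<alpha> h F z))\<^sup>2 * fock_weight \<alpha> z
    = exp (\<alpha> * (cmod h)\<^sup>2) * ((cmod (F (z - h)))\<^sup>2 * fock_weight \<alpha> (z - h))"
proof -
  have "(exp (Re (of_real \<alpha> * cnj h * z)))\<^sup>2 * fock_weight \<alpha> z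
      = exp (\<alpha> * (cmod h)\<^sup>2) * fock_weight \<alpha> (z - h)"
    unfolding fock_weight_def exp_double[symmetric] exp_add[symmetric] cmod_power2
    by (rule arg_cong[where f = exp]) (simp add: algebra_simps power2_eq_square)
  then show ?thesis
    unfolding twisted_shift_def norm_mult norm_exp_eq_Re power_mult_distrib
    by (metis mult.assoc mult.commute)
qed

lemma twisted_shift_in_fock_space:
  assumes F: "F \<in> fock_space \<alpha>"
  shows "twisted_shift \<alpha> h F \<in> fock_space \<alpha>"
    and "fock_energy \<alpha> (twisted_shift \<alpha> h F) = exp (\<alpha> * (cmod h)\<^sup>2) * fock_energy \<alpha> F"
proof -
  let ?f = "\<lambda>z. (cmod (F z))\<^sup>2 * fock_weight \<alpha> z"
  have hol: "F holomorphic_on UNIV" using fock_space_holomorphic[OF F] .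
  have [measurable]: "F \<in> borel_measurable borel" using entire_borel_measurable[OF hol] .
  have distr: "distr lborel borel (\<lambda>z. z - h) = lborel"
  proof -
    have "(\<lambda>z. z - h) = (+) (- h)" by (auto simp: fun_eq_iff)
    then show ?thesis by (simp only: lborel_distr_plus)
  qed
  have int: "integrable lborel ?f" using F by (simp add: fock_space_def)
  then have "integrable (distr lborel borel (\<lambda>z. z - h)) ?f" by (simp add: distr)
  then have int': "integrable lborel (\<lambda>z. ?f (z - h))"
    by (subst (asm) integrable_distr_eq) auto
  have "(LINT z|lborel. ?f (z - h)) = integral\<^sup>L (distr lborel borel (\<lambda>z. z - h)) ?f"
    by (rule integral_distr[symmetric]) auto
  then have eq: "(LINT z|lborel. ?f (z - h)) = integral\<^sup>L lborel ?f" by (simp add: distr)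
  have hol': "twisted_shift \<alpha> h F holomorphic_on UNIV"
  proof -
    have "(F \<circ> (\<lambda>z. z - h)) holomorphic_on UNIV"
      by (rule holomorphic_on_compose_gen[OF _ hol]) (auto intro!: holomorphic_intros)
    then show ?thesis
      unfolding twisted_shift_def[abs_def] by (auto intro!: holomorphic_intros simp: o_def)
  qed
  from hol' int' show "twisted_shift \<alpha> h F \<in> fock_space \<alpha>"
    by (simp add: fock_space_def twisted_shift_weight)
  from eq show "fock_energy \<alpha> (twisted_shift \<alpha> h F) = exp (\<alpha> * (cmod h)\<^sup>2) * fock_energy \<alpha> F"
    by (simp add: fock_energy_def twisted_shift_weight)
qed

section \<open>Linear combinations and limits\<close>

lemma fock_space_cmult:
  assumes "F \<in> fock_space \<alpha>"
  shows "(\<lambda>z. c * F z) \<in> fock_space \<alpha>"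
    and "fock_energy \<alpha> (\<lambda>z. c * F z) = (cmod c)\<^sup>2 * fock_energy \<alpha> F"
  using assms
  by (auto simp: fock_space_def fock_energy_def norm_mult power_mult_distrib mult.assoc
      intro!: holomorphic_intros)

lemma fock_space_add:
  assumes F: "F \<in> fock_space \<alpha>" and G: "G \<in> fock_space \<alpha>"
  shows "(\<lambda>z. F z + G z) \<in> fock_space \<alpha>"
proof -
  have [measurable]: "F \<in> borel_measurable borel" "G \<in> borel_measurable borel"
    using F G by (auto intro: entire_borel_measurable fock_space_holomorphic)
  have "integrable lborel
      (\<lambda>z. 2 * ((cmod (F z))\<^sup>2 * fock_weight \<alpha> z) + 2 * ((cmod (G z))\<^sup>2 * fock_weight \<alpha> z))"
    using F G by (auto simp: fock_space_def)
  moreover have "AE z in lborel. norm ((cmod (F z + G z))\<^sup>2 * fock_weight \<alpha> z)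
      \<le> norm (2 * ((cmod (F z))\<^sup>2 * fock_weight \<alpha> z) + 2 * ((cmod (G z))\<^sup>2 * fock_weight \<alpha> z))"
  proof (rule AE_I2)
    fix z
    have "(cmod (F z + G z))\<^sup>2 \<le> (cmod (F z) + cmod (G z))\<^sup>2"
      by (intro power_mono norm_triangle_ineq) auto
    also have "\<dots> \<le> 2 * (cmod (F z))\<^sup>2 + 2 * (cmod (G z))\<^sup>2"
      using sum_squares_bound[of "cmod (F z)" "cmod (G z)"] by (simp add: power2_sum)
    finally show "norm ((cmod (F z + G z))\<^sup>2 * fock_weight \<alpha> z)
      \<le> norm (2 * ((cmod (F z))\<^sup>2 * fock_weight \<alpha> z) + 2 * ((cmod (G z))\<^sup>2 * fock_weight \<alpha> z))"
      using fock_weight_pos[of \<alpha> z]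
        mult_right_mono[of "(cmod (F z + G z))\<^sup>2" "2 * (cmod (F z))\<^sup>2 + 2 * (cmod (G z))\<^sup>2" "fock_weight \<alpha> z"]
      by (simp add: algebra_simps)
  qed
  ultimately have "integrable lborel (\<lambda>z. (cmod (F z + G z))\<^sup>2 * fock_weight \<alpha> z)"
    by (elim Bochner_Integration.integrable_bound) measurable
  then show ?thesis
    using F G by (auto simp: fock_space_def intro!: holomorphic_intros)
qed

lemma fock_space_diff:
  assumes "F \<in> fock_space \<alpha>" "G \<in> fock_space \<alpha>"
  shows "(\<lambda>z. F z - G z) \<in> fock_space \<alpha>"
  using fock_space_add[OF assms(1) fock_space_cmult(1)[OF assms(2), of "-1"]] by simp

text \<open>The lemma of Fatou: boundedness in norm passes to pointwise limits.\<close>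

lemma fock_space_limit:
  assumes hol: "F holomorphic_on UNIV"
    and lim: "\<And>z. (\<lambda>n. G n z) \<longlonglongrightarrow> F z"
    and G: "\<And>n. G n \<in> fock_space \<alpha>"
    and bound: "\<And>n. fock_energy \<alpha> (G n) \<le> C"
  shows "F \<in> fock_space \<alpha>"
proof -
  have [measurable]: "F \<in> borel_measurable borel" "G n \<in> borel_measurable borel" for n
    using hol G by (auto intro: entire_borel_measurable fock_space_holomorphic)
  let ?e = "\<lambda>G z. ennreal ((cmod (G z))\<^sup>2 * fock_weight \<alpha> z)"
  have energy: "(\<integral>\<^sup>+ z. ?e (G n) z \<partial>lborel) \<le> ennreal C" for n
  proof -
    have "(\<integral>\<^sup>+ z. ?e (G n) z \<partial>lborel) = ennreal (fock_energy \<alpha> (G n))"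
      unfolding fock_energy_def using G[of n]
      by (intro nn_integral_eq_integral) (auto simp: fock_space_def fock_weight_def)
    then show ?thesis using bound[of n] by (simp add: ennreal_leI)
  qed
  have pt: "?e F z = liminf (\<lambda>n. ?e (G n) z)" for z
  proof -
    have "(\<lambda>n. ?e (G n) z) \<longlonglongrightarrow> ?e F z"
      by (intro tendsto_ennrealI tendsto_intros lim)
    then show ?thesis by (metis lim_imp_Liminf sequentially_bot)
  qed
  have "(\<integral>\<^sup>+ z. ?e F z \<partial>lborel) = (\<integral>\<^sup>+ z. liminf (\<lambda>n. ?e (G n) z) \<partial>lborel)"
    by (simp add: pt)
  also have "\<dots> \<le> liminf (\<lambda>n. \<integral>\<^sup>+ z. ?e (G n) z \<partial>lborel)"
    by (rule nn_integral_liminf) measurable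
  also have "\<dots> \<le> ennreal C"
    using energy by (intro Liminf_le) auto
  also have "\<dots> < \<infinity>" by simp
  finally have "integrable lborel (\<lambda>z. (cmod (F z))\<^sup>2 * fock_weight \<alpha> z)"
    by (intro integrableI_bounded) (auto simp: fock_weight_def)
  with hol show ?thesis by (simp add: fock_space_def)
qed

section \<open>A Schwarz lemma for finite families\<close>

text \<open>Pairing the family with its own increments \<open>D i\<close> reduces the \<open>\<ell>\<^sup>2\<close> statement to one scalar
  function: by Cauchy-Schwarz that function is bounded on the disc, and at \<open>h\<close> it takes the value
  \<open>\<Sum>i. \<bar>D i\<bar>\<^sup>2\<close>, so the Schwarz lemma bounds this sum by a multiple of its own square root.\<close>

lemma family_schwarz_bound:
  fixes \<Phi> :: "'i \<Rightarrow> complex \<Rightarrow> complex"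
  assumes fin: "finite S"
    and hol: "\<And>i. i \<in> S \<Longrightarrow> \<Phi> i holomorphic_on ball 0 1"
    and bound: "\<And>\<zeta>. cmod \<zeta> < 1 \<Longrightarrow> (\<Sum>i\<in>S. (cmod (\<Phi> i \<zeta>))\<^sup>2) \<le> K\<^sup>2"
    and K: "K > 0" and h: "cmod h < 1"
  shows "(\<Sum>i\<in>S. (cmod (\<Phi> i h - \<Phi> i 0))\<^sup>2) \<le> (3 * K * cmod h)\<^sup>2"
proof -
  define D where "D i = \<Phi> i h - \<Phi> i 0" for i
  define d where "d = L2_set (\<lambda>i. cmod (D i)) S"
  have d2: "d\<^sup>2 = (\<Sum>i\<in>S. (cmod (D i))\<^sup>2)"
    by (simp add: d_def L2_set_def sum_nonneg)
  have d0: "d \<ge> 0" by (simp add: d_def)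
  have "d \<le> 3 * K * cmod h"
  proof (cases "d = 0")
    case False
    with d0 have d: "d > 0" by simp
    have pair: "cmod (\<Sum>i\<in>S. cnj (D i) * \<Phi> i \<zeta>) \<le> d * K" if "cmod \<zeta> < 1" for \<zeta>
    proof -
      have "cmod (\<Sum>i\<in>S. cnj (D i) * \<Phi> i \<zeta>) \<le> (\<Sum>i\<in>S. \<bar>cmod (D i)\<bar> * \<bar>cmod (\<Phi> i \<zeta>)\<bar>)"
        by (rule sum_norm_le) (simp add: norm_mult)
      also have "\<dots> \<le> d * L2_set (\<lambda>i. cmod (\<Phi> i \<zeta>)) S"
        unfolding d_def by (rule L2_set_mult_ineq)
      also have "\<dots> \<le> d * K"
        using bound[OF that] K d0
        by (intro mult_left_mono) (auto simp: L2_set_def intro!: real_le_lsqrt sum_nonneg)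
      finally show ?thesis .
    qed
    \<comment> \<open>The numerator is at most \<open>2 * K * d\<close>; the factor 3 makes the bound 1 strict.\<close>
    define \<Psi> where "\<Psi> \<zeta> = (\<Sum>i\<in>S. cnj (D i) * (\<Phi> i \<zeta> - \<Phi> i 0)) / of_real (3 * K * d)" for \<zeta>
    have "\<Psi> holomorphic_on ball 0 1"
      unfolding \<Psi>_def[abs_def] using hol d K by (auto intro!: holomorphic_intros)
    moreover have "\<Psi> 0 = 0" by (simp add: \<Psi>_def)
    moreover have "cmod (\<Psi> \<zeta>) < 1" if "cmod \<zeta> < 1" for \<zeta>
    proof -
      have "cmod (\<Sum>i\<in>S. cnj (D i) * (\<Phi> i \<zeta> - \<Phi> i 0))
          \<le> cmod (\<Sum>i\<in>S. cnj (D i) * \<Phi> i \<zeta>) + cmod (\<Sum>i\<in>S. cnj (D i) * \<Phi> i 0)"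
        by (simp add: right_diff_distrib sum_subtractf norm_triangle_ineq4)
      also have "\<dots> \<le> d * K + d * K"
        by (intro add_mono pair) (use that in auto)
      also have "\<dots> < 3 * K * d" using d K by simp
      finally show ?thesis using d K by (simp add: \<Psi>_def norm_divide norm_mult)
    qed
    ultimately have "cmod (\<Psi> h) \<le> cmod h" using h by (rule Schwarz_Lemma(1))
    moreover have "\<Psi> h = of_real (d / (3 * K))"
    proof -
      have "(\<Sum>i\<in>S. cnj (D i) * (\<Phi> i h - \<Phi> i 0)) = of_real (d\<^sup>2)"
        unfolding d2 D_def[symmetric] of_real_sum
        by (intro sum.cong refl) (metis complex_norm_square mult.commute of_real_power)
      then show ?thesis using d K by (simp add: \<Psi>_def power2_eq_square)
    qed
    ultimately show ?thesis using d K
      by (simp add: norm_divide norm_mult field_simps)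
  qed (use K in auto)
  then have "d\<^sup>2 \<le> (3 * K * cmod h)\<^sup>2" using d0 by (rule power_mono)
  then show ?thesis by (simp add: d2 D_def)
qed

lemma cmod_exp_i_minus_one: "cmod (exp (\<i> * of_real x) - 1) \<le> \<bar>x\<bar>"
  using abs_sin_x_le_abs_x[of "x / 2"] by (simp add: dist_exp_i_1)

section \<open>The sampling inequalities\<close>

text \<open>Both inequalities are phrased through finite subsets of \<open>\<Gamma>\<close>, which avoids all questions of
  summability.\<close>

locale fock_sampling =
  fixes \<alpha> a b :: real and \<Gamma> :: "complex set"
  assumes alpha: "\<alpha> > 0" and a: "a > 0" and b: "b > 0"
    and upper: "\<And>F S. F \<in> fock_space \<alpha> \<Longrightarrow> finite S \<Longrightarrow> S \<subseteq> \<Gamma> \<Longrightarrow>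
      (\<Sum>\<gamma>\<in>S. (cmod (F \<gamma>))\<^sup>2 * fock_weight \<alpha> \<gamma>) \<le> b * fock_energy \<alpha> F"
    and lower: "\<And>F K. F \<in> fock_space \<alpha> \<Longrightarrow>
      (\<And>S. finite S \<Longrightarrow> S \<subseteq> \<Gamma> \<Longrightarrow> (\<Sum>\<gamma>\<in>S. (cmod (F \<gamma>))\<^sup>2 * fock_weight \<alpha> \<gamma>) \<le> K) \<Longrightarrow>
      a * fock_energy \<alpha> F \<le> K"

lemma stable_sampling_imp_fock_sampling:
  assumes "\<alpha> > 0" and "stable_sampling \<alpha> \<Gamma>"
  obtains a b where "fock_sampling \<alpha> a b \<Gamma>"
proof -
  obtain A B where A: "A > 0" and B: "B > 0" and AB: "\<And>F. F \<in> fock_space \<alpha> \<Longrightarrow>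
        (\<lambda>\<gamma>. fock_weight \<alpha> \<gamma> * (cmod (F \<gamma>))\<^sup>2) summable_on \<Gamma> \<and>
        A * (fock_norm \<alpha> F)\<^sup>2 \<le> (\<Sum>\<^sub>\<infinity>\<gamma>\<in>\<Gamma>. fock_weight \<alpha> \<gamma> * (cmod (F \<gamma>))\<^sup>2) \<and>
        (\<Sum>\<^sub>\<infinity>\<gamma>\<in>\<Gamma>. fock_weight \<alpha> \<gamma> * (cmod (F \<gamma>))\<^sup>2) \<le> B * (fock_norm \<alpha> F)\<^sup>2"
    using assms(2) unfolding stable_sampling_def by blast
  have "fock_sampling \<alpha> (A * (\<alpha> / pi)) (B * (\<alpha> / pi)) \<Gamma>"
  proof
    fix F S assume F: "F \<in> fock_space \<alpha>" and S: "finite S" "S \<subseteq> \<Gamma>"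
    have "(\<Sum>\<gamma>\<in>S. fock_weight \<alpha> \<gamma> * (cmod (F \<gamma>))\<^sup>2)
        \<le> (\<Sum>\<^sub>\<infinity>\<gamma>\<in>\<Gamma>. fock_weight \<alpha> \<gamma> * (cmod (F \<gamma>))\<^sup>2)"
      using AB[OF F] S by (intro finite_sum_le_infsum) (auto simp: fock_weight_def)
    also have "\<dots> \<le> B * (fock_norm \<alpha> F)\<^sup>2" using AB[OF F] by blast
    finally show "(\<Sum>\<gamma>\<in>S. (cmod (F \<gamma>))\<^sup>2 * fock_weight \<alpha> \<gamma>) \<le> B * (\<alpha> / pi) * fock_energy \<alpha> F"
      by (simp add: fock_norm_sq[OF assms(1)] mult_ac)
  next
    fix F K
    assume F: "F \<in> fock_space \<alpha>" and sums: "\<And>S. finite S \<Longrightarrow> S \<subseteq> \<Gamma> \<Longrightarrow>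
      (\<Sum>\<gamma>\<in>S. (cmod (F \<gamma>))\<^sup>2 * fock_weight \<alpha> \<gamma>) \<le> K"
    have "A * (fock_norm \<alpha> F)\<^sup>2 \<le> (\<Sum>\<^sub>\<infinity>\<gamma>\<in>\<Gamma>. fock_weight \<alpha> \<gamma> * (cmod (F \<gamma>))\<^sup>2)"
      using AB[OF F] by blast
    also have "\<dots> \<le> K"
      using AB[OF F] sums by (intro infsum_le_finite_sums) (auto simp: mult.commute)
    finally show "A * (\<alpha> / pi) * fock_energy \<alpha> F \<le> K"
      by (simp add: fock_norm_sq[OF assms(1)] mult_ac)
  qed (use A B assms(1) in auto)
  then show thesis by (rule that)
qed

context fock_sampling
begin

lemma energy_le_of_sums:
  assumes F: "F \<in> fock_space \<alpha>"
    and "\<And>S. finite S \<Longrightarrow> S \<subseteq> \<Gamma> \<Longrightarrow> (\<Sum>\<gamma>\<in>S. (cmod (F \<gamma>))\<^sup>2 * fock_weight \<alpha> \<gamma>) \<le> K"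
  shows "fock_energy \<alpha> F \<le> K / a"
  using lower[OF assms] a by (simp add: field_simps)

lemma nonempty: "\<Gamma> \<noteq> {}"
proof
  assume "\<Gamma> = {}"
  then have "a * fock_energy \<alpha> (\<lambda>z. 1) \<le> 0"
    by (intro lower one_in_fock_space alpha) auto
  with a fock_energy_one_pos[OF alpha] show False
    by (simp add: mult_le_0_iff)
qed

text \<open>A translation moves \<open>w\<close> to a point of \<open>\<Gamma>\<close>, where the upper sampling inequality contains
  the point evaluation as a single term.\<close>

lemma pointwise_bound:
  assumes F: "F \<in> fock_space \<alpha>"
  shows "(cmod (F w))\<^sup>2 * fock_weight \<alpha> w \<le> b * fock_energy \<alpha> F"
proof -
  obtain \<gamma> where \<gamma>: "\<gamma> \<in> \<Gamma>" using nonempty by blast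
  define h where "h = \<gamma> - w"
  have "exp (\<alpha> * (cmod h)\<^sup>2) * ((cmod (F w))\<^sup>2 * fock_weight \<alpha> w)
      \<le> b * (exp (\<alpha> * (cmod h)\<^sup>2) * fock_energy \<alpha> F)"
    using upper[OF twisted_shift_in_fock_space(1)[OF F, of h], of "{\<gamma>}"] \<gamma>
    unfolding twisted_shift_in_fock_space(2)[OF F]
    by (simp add: twisted_shift_weight h_def)
  then show ?thesis by (simp add: mult.left_commute[of b])
qed

section \<open>Multiplication by the variable\<close>

text \<open>Up to a unimodular factor, the weighted sample at \<open>\<gamma>\<close> of the translate of \<open>F\<close> by \<open>- \<zeta>\<close>, written so that it is
  holomorphic in \<open>\<zeta>\<close>.\<close>

definition recentred :: "(complex \<Rightarrow> complex) \<Rightarrow> complex \<Rightarrow> complex \<Rightarrow> complex" where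
  "recentred F \<gamma> \<zeta> = F (\<gamma> + \<zeta>) * exp (- (of_real \<alpha> * cnj \<gamma> * \<zeta>) - of_real (\<alpha> / 2 * (cmod \<gamma>)\<^sup>2))"

lemma recentred_sq:
  "(cmod (recentred F \<gamma> \<zeta>))\<^sup>2 = (cmod (twisted_shift \<alpha> (- \<zeta>) F \<gamma>))\<^sup>2 * fock_weight \<alpha> \<gamma>"
proof -
  have 1: "cnj \<zeta> * \<gamma> = cnj (cnj \<gamma> * \<zeta>)" by simp
  have 2: "Re (of_real \<alpha> * cnj (- \<zeta>) * \<gamma>) = - Re (of_real \<alpha> * cnj \<gamma> * \<zeta>)"
    by (simp add: algebra_simps)
  have 3: "(exp (- Re (of_real \<alpha> * cnj \<gamma> * \<zeta>) - \<alpha> / 2 * (cmod \<gamma>)\<^sup>2))\<^sup>2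
      = (exp (- Re (of_real \<alpha> * cnj \<gamma> * \<zeta>)))\<^sup>2 * fock_weight \<alpha> \<gamma>"
    unfolding fock_weight_def exp_double[symmetric] exp_add[symmetric]
    by (rule arg_cong[where f = exp]) (simp add: algebra_simps)
  show ?thesis
    unfolding recentred_def twisted_shift_def norm_mult norm_exp_eq_Re power_mult_distrib 2
    using 3 by simp
qed

text \<open>The translation changes the sample at \<open>\<gamma>\<close> in two ways. The phase
  \<open>u = exp (\<alpha> * (cnj h * \<gamma> - cnj \<gamma> * h))\<close> satisfies \<open>\<bar>u - 1\<bar> \<le> 2 * \<alpha> * \<bar>h\<bar> * \<bar>\<gamma>\<bar>\<close>, which is
  what the bound \<open>Q\<close> absorbs; the rest is the increment from 0 to \<open>- h\<close> of the recentred function,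
  which the Schwarz lemma for families bounds uniformly over finite sets of samples.\<close>

lemma shift_difference_samples:
  assumes F: "F \<in> fock_space \<alpha>"
    and Q: "\<And>S. finite S \<Longrightarrow> S \<subseteq> \<Gamma> \<Longrightarrow>
      (\<Sum>\<gamma>\<in>S. (cmod \<gamma>)\<^sup>2 * ((cmod (F \<gamma>))\<^sup>2 * fock_weight \<alpha> \<gamma>)) \<le> Q"
  obtains C where "\<And>h S. cmod h < 1 \<Longrightarrow> finite S \<Longrightarrow> S \<subseteq> \<Gamma> \<Longrightarrow>
    (\<Sum>\<gamma>\<in>S. (cmod (twisted_shift \<alpha> h F \<gamma> - F \<gamma>))\<^sup>2 * fock_weight \<alpha> \<gamma>) \<le> C * (cmod h)\<^sup>2"
proof -
  \<comment> \<open>The summand 1 only serves to make the bound positive.\<close>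
  define K where "K = sqrt (b * (exp \<alpha> * fock_energy \<alpha> F) + 1)"
  have pos: "b * (exp \<alpha> * fock_energy \<alpha> F) \<ge> 0"
    using b fock_energy_nonneg by simp
  then have K: "K > 0" and K2: "K\<^sup>2 = b * (exp \<alpha> * fock_energy \<alpha> F) + 1"
    by (auto simp: K_def)
  let ?\<Phi> = "recentred F"
  have hol: "?\<Phi> \<gamma> holomorphic_on ball 0 1" for \<gamma>
  proof -
    have "(F \<circ> (\<lambda>\<zeta>. \<gamma> + \<zeta>)) holomorphic_on ball 0 1"
      by (rule holomorphic_on_compose_gen[OF _ fock_space_holomorphic[OF F]])
        (auto intro!: holomorphic_intros)
    then show ?thesis
      unfolding recentred_def[abs_def] by (auto intro!: holomorphic_intros simp: o_def)
  qed
  have ball: "(\<Sum>\<gamma>\<in>S. (cmod (?\<Phi> \<gamma> \<zeta>))\<^sup>2) \<le> K\<^sup>2" if "finite S" "S \<subseteq> \<Gamma>" "cmod \<zeta> < 1" for S \<zeta>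
  proof -
    have "(\<Sum>\<gamma>\<in>S. (cmod (?\<Phi> \<gamma> \<zeta>))\<^sup>2) \<le> b * (exp (\<alpha> * (cmod \<zeta>)\<^sup>2) * fock_energy \<alpha> F)"
      using upper[OF twisted_shift_in_fock_space(1)[OF F, of "- \<zeta>"] that(1,2)]
      by (simp add: recentred_sq twisted_shift_in_fock_space(2)[OF F])
    also have "\<dots> \<le> b * (exp \<alpha> * fock_energy \<alpha> F)"
      using that(3) alpha b fock_energy_nonneg
      by (intro mult_left_mono mult_right_mono) (auto simp: power_le_one abs_square_le_1)
    finally show ?thesis by (simp add: K2)
  qed
  have pt: "(cmod (twisted_shift \<alpha> h F \<gamma> - F \<gamma>))\<^sup>2 * fock_weight \<alpha> \<gamma>
      \<le> 2 * (cmod (?\<Phi> \<gamma> (- h) - ?\<Phi> \<gamma> 0))\<^sup>2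
        + 8 * \<alpha>\<^sup>2 * (cmod h)\<^sup>2 * ((cmod \<gamma>)\<^sup>2 * ((cmod (F \<gamma>))\<^sup>2 * fock_weight \<alpha> \<gamma>))" for h \<gamma>
  proof -
    define g where "g = exp (- of_real (\<alpha> / 2 * (cmod \<gamma>)\<^sup>2) :: complex)"
    have g: "(cmod g)\<^sup>2 = fock_weight \<alpha> \<gamma>"
      by (simp add: g_def norm_exp_eq_Re fock_weight_def exp_double[symmetric])
    define u where "u = exp (of_real \<alpha> * cnj h * \<gamma> - of_real \<alpha> * cnj \<gamma> * h)"
    have u_eq: "of_real \<alpha> * cnj h * \<gamma> - of_real \<alpha> * cnj \<gamma> * h = \<i> * of_real (2 * \<alpha> * Im (cnj h * \<gamma>))"
      by (simp add: complex_eq_iff algebra_simps)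
    have u1: "cmod u = 1" unfolding u_def u_eq by (simp add: norm_exp_eq_Re)
    have "cmod (u - 1) \<le> \<bar>2 * \<alpha> * Im (cnj h * \<gamma>)\<bar>"
      unfolding u_def u_eq by (rule cmod_exp_i_minus_one)
    also have "\<dots> \<le> 2 * \<alpha> * (cmod h * cmod \<gamma>)"
      using alpha abs_Im_le_cmod[of "cnj h * \<gamma>"] by (simp add: abs_mult norm_mult)
    finally have u2: "cmod (u - 1) \<le> 2 * \<alpha> * (cmod h * cmod \<gamma>)" .
    have t: "twisted_shift \<alpha> h F \<gamma> * g = u * ?\<Phi> \<gamma> (- h)"
      by (simp add: twisted_shift_def g_def u_def recentred_def mult_ac exp_add[symmetric])
    have z: "F \<gamma> * g = ?\<Phi> \<gamma> 0" by (simp add: recentred_def g_def)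
    have "(twisted_shift \<alpha> h F \<gamma> - F \<gamma>) * g = u * (?\<Phi> \<gamma> (- h) - ?\<Phi> \<gamma> 0) + (u - 1) * (F \<gamma> * g)"
      by (simp add: z[symmetric] left_diff_distrib t[symmetric] right_diff_distrib)
    then have "cmod ((twisted_shift \<alpha> h F \<gamma> - F \<gamma>) * g)
        \<le> cmod (u * (?\<Phi> \<gamma> (- h) - ?\<Phi> \<gamma> 0)) + cmod ((u - 1) * (F \<gamma> * g))"
      by (simp only: norm_triangle_ineq)
    also have "\<dots> \<le> cmod (?\<Phi> \<gamma> (- h) - ?\<Phi> \<gamma> 0) + 2 * \<alpha> * (cmod h * cmod \<gamma>) * cmod (F \<gamma> * g)"
      using u2 by (auto simp: norm_mult u1 intro!: mult_right_mono)
    finally have "(cmod ((twisted_shift \<alpha> h F \<gamma> - F \<gamma>) * g))\<^sup>2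
        \<le> (cmod (?\<Phi> \<gamma> (- h) - ?\<Phi> \<gamma> 0) + 2 * \<alpha> * (cmod h * cmod \<gamma>) * cmod (F \<gamma> * g))\<^sup>2"
      by (rule power_mono) simp
    also have "\<dots> \<le> 2 * (cmod (?\<Phi> \<gamma> (- h) - ?\<Phi> \<gamma> 0))\<^sup>2
        + 2 * (2 * \<alpha> * (cmod h * cmod \<gamma>) * cmod (F \<gamma> * g))\<^sup>2"
      using sum_squares_bound[of "cmod (?\<Phi> \<gamma> (- h) - ?\<Phi> \<gamma> 0)" "2 * \<alpha> * (cmod h * cmod \<gamma>) * cmod (F \<gamma> * g)"]
      by (simp add: power2_sum)
    finally show ?thesis
      by (simp add: norm_mult power_mult_distrib g mult_ac)
  qed
  show thesis
  proof (rule that)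
    fix h S assume h: "cmod h < 1" and S: "finite S" "S \<subseteq> \<Gamma>"
    have "(\<Sum>\<gamma>\<in>S. (cmod (twisted_shift \<alpha> h F \<gamma> - F \<gamma>))\<^sup>2 * fock_weight \<alpha> \<gamma>)
        \<le> (\<Sum>\<gamma>\<in>S. 2 * (cmod (?\<Phi> \<gamma> (- h) - ?\<Phi> \<gamma> 0))\<^sup>2
        + 8 * \<alpha>\<^sup>2 * (cmod h)\<^sup>2 * ((cmod \<gamma>)\<^sup>2 * ((cmod (F \<gamma>))\<^sup>2 * fock_weight \<alpha> \<gamma>)))"
      by (rule sum_mono) (rule pt)
    also have "\<dots> = 2 * (\<Sum>\<gamma>\<in>S. (cmod (?\<Phi> \<gamma> (- h) - ?\<Phi> \<gamma> 0))\<^sup>2)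
        + 8 * \<alpha>\<^sup>2 * (cmod h)\<^sup>2 * (\<Sum>\<gamma>\<in>S. (cmod \<gamma>)\<^sup>2 * ((cmod (F \<gamma>))\<^sup>2 * fock_weight \<alpha> \<gamma>))"
      by (simp only: sum.distrib sum_distrib_left)
    also have "\<dots> \<le> 2 * (3 * K * cmod (- h))\<^sup>2 + 8 * \<alpha>\<^sup>2 * (cmod h)\<^sup>2 * Q"
      using h S Q[OF S] K
      by (intro add_mono mult_left_mono family_schwarz_bound hol ball) auto
    also have "\<dots> = (18 * K\<^sup>2 + 8 * \<alpha>\<^sup>2 * Q) * (cmod h)\<^sup>2"
      by (simp add: power_mult_distrib algebra_simps)
    finally show "(\<Sum>\<gamma>\<in>S. (cmod (twisted_shift \<alpha> h F \<gamma> - F \<gamma>))\<^sup>2 * fock_weight \<alpha> \<gamma>)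
        \<le> (18 * K\<^sup>2 + 8 * \<alpha>\<^sup>2 * Q) * (cmod h)\<^sup>2" .
  qed
qed

text \<open>The derivative at 0 of the Weyl translations in a direction \<open>c\<close> is
  \<open>\<alpha> * cnj c * z * F - c * deriv F\<close>. It lies in the space because its difference quotients are bounded
  there; the directions \<open>1\<close> and \<open>\<i>\<close> are then combined so that \<open>deriv F\<close> cancels.\<close>

lemma mult_id_in_fock_space:
  assumes F: "F \<in> fock_space \<alpha>"
    and Q: "\<And>S. finite S \<Longrightarrow> S \<subseteq> \<Gamma> \<Longrightarrow>
      (\<Sum>\<gamma>\<in>S. (cmod \<gamma>)\<^sup>2 * ((cmod (F \<gamma>))\<^sup>2 * fock_weight \<alpha> \<gamma>)) \<le> Q"
  shows "(\<lambda>z. z * F z) \<in> fock_space \<alpha>"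
proof -
  have hol: "F holomorphic_on UNIV" using F by (rule fock_space_holomorphic)
  obtain C where C: "\<And>h S. cmod h < 1 \<Longrightarrow> finite S \<Longrightarrow> S \<subseteq> \<Gamma> \<Longrightarrow>
    (\<Sum>\<gamma>\<in>S. (cmod (twisted_shift \<alpha> h F \<gamma> - F \<gamma>))\<^sup>2 * fock_weight \<alpha> \<gamma>) \<le> C * (cmod h)\<^sup>2"
    using shift_difference_samples[OF F Q] by blast
  have dir: "(\<lambda>z. of_real \<alpha> * cnj c * (z * F z) - c * deriv F z) \<in> fock_space \<alpha>"
    if c: "cmod c = 1" for c
  proof -
    define t :: "nat \<Rightarrow> real" where "t n = 1 / real (n + 2)" for n
    have t: "0 < t n" "t n < 1" for n by (auto simp: t_def)
    have t0: "t \<longlonglongrightarrow> 0"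
      unfolding t_def by real_asymp
    define G where "G n z = 1 / of_real (t n) * (twisted_shift \<alpha> (of_real (t n) * c) F z - F z)" for n z
    have diff: "(\<lambda>z. twisted_shift \<alpha> h F z - F z) \<in> fock_space \<alpha>" for h
      by (intro fock_space_diff twisted_shift_in_fock_space F)
    show ?thesis
    proof (rule fock_space_limit)
      show "(\<lambda>z. of_real \<alpha> * cnj c * (z * F z) - c * deriv F z) holomorphic_on UNIV"
        using hol by (auto intro!: holomorphic_intros)
      show "G n \<in> fock_space \<alpha>" for n
        unfolding G_def[abs_def] by (rule fock_space_cmult(1)[OF diff])
      show "fock_energy \<alpha> (G n) \<le> C / a" for n
      proof -
        have "fock_energy \<alpha> (\<lambda>z. twisted_shift \<alpha> (of_real (t n) * c) F z - F z)
            \<le> C * (cmod (of_real (t n) * c))\<^sup>2 / a"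
          using t[of n] by (intro energy_le_of_sums diff C) (auto simp: norm_mult c)
        then have "fock_energy \<alpha> (\<lambda>z. twisted_shift \<alpha> (of_real (t n) * c) F z - F z)
            \<le> C / a * (t n)\<^sup>2"
          using t[of n] by (simp add: norm_mult c)
        then show ?thesis
          using t[of n] unfolding G_def[abs_def] fock_space_cmult(2)[OF diff]
          by (simp add: norm_divide power_divide field_simps)
      qed
      show "(\<lambda>n. G n z) \<longlonglongrightarrow> of_real \<alpha> * cnj c * (z * F z) - c * deriv F z" for z
      proof -
        \<comment> \<open>For real \<open>s\<close> the conjugate of \<open>s * c\<close> is \<open>s * cnj c\<close>, so the translate extends
            holomorphically to complex \<open>s\<close>.\<close>
        define \<phi> where "\<phi> s = exp (of_real \<alpha> * (s * cnj c) * z) * F (z - s * c)" for s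
        have "(F has_field_derivative deriv F z) (at (z - 0 * c))"
          using holomorphic_derivI[OF hol open_UNIV, of z] by simp
        then have "(\<phi> has_field_derivative of_real \<alpha> * cnj c * (z * F z) - c * deriv F z) (at 0)"
          unfolding \<phi>_def[abs_def]
          by (auto intro!: derivative_eq_intros DERIV_chain2[of F] simp: algebra_simps)
        then have "((\<lambda>s. (\<phi> s - \<phi> 0) / s) \<longlongrightarrow> of_real \<alpha> * cnj c * (z * F z) - c * deriv F z) (at 0)"
          by (simp add: DERIV_def)
        moreover have "filterlim (\<lambda>n. complex_of_real (t n)) (at 0) sequentially"
          using t tendsto_of_real[OF t0, where 'a = complex]
          by (auto simp: filterlim_at less_imp_neq[symmetric] intro!: always_eventually)
        ultimately have "(\<lambda>n. (\<phi> (of_real (t n)) - \<phi> 0) / of_real (t n))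
            \<longlonglongrightarrow> of_real \<alpha> * cnj c * (z * F z) - c * deriv F z"
          by (rule filterlim_compose)
        then show ?thesis by (simp add: \<phi>_def G_def twisted_shift_def)
      qed
    qed
  qed
  have "(\<lambda>z. 1 / (2 * of_real \<alpha>) * ((of_real \<alpha> * cnj 1 * (z * F z) - 1 * deriv F z)
      + \<i> * (of_real \<alpha> * cnj \<i> * (z * F z) - \<i> * deriv F z))) \<in> fock_space \<alpha>"
    by (intro fock_space_cmult fock_space_add dir) auto
  moreover have "1 / (2 * of_real \<alpha>) * ((of_real \<alpha> * cnj 1 * (z * F z) - 1 * deriv F z)
      + \<i> * (of_real \<alpha> * cnj \<i> * (z * F z) - \<i> * deriv F z)) = z * F z" for z
    using alpha by (simp add: field_simps)
  ultimately show ?thesis by simp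
qed

end

section \<open>Growth of functions that are bounded on a sampling set\<close>

lemma exp_power_series: "(\<lambda>n. x ^ n / fact n) sums exp (x::real)"
  using exp_converges[of x] by (simp add: divide_inverse mult.commute)

lemma power_div_fact_le_exp:
  fixes x :: real
  assumes "x \<ge> 0"
  shows "x ^ n / fact n \<le> exp x"
proof -
  have "(\<Sum>k\<in>{n}. x ^ k / fact k) \<le> exp x"
    using assms exp_power_series[of x] by (metis (no_types, lifting) divide_nonneg_pos fact_gt_zero finite.emptyI finite.insertI
        sum_le_suminf sums_iff zero_le_power)
  then show ?thesis by simp
qed

lemma exp_quadratic_in_fock_space:
  assumes "0 \<le> c" "2 * c < \<alpha>" and "cmod \<omega> = 1"
  shows "(\<lambda>z. exp (of_real c * \<omega> * z\<^sup>2)) \<in> fock_space \<alpha>"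
proof (rule fock_space_growthI[where t = "2 * c" and C = 1])
  fix z :: complex
  have "Re (of_real c * \<omega> * z\<^sup>2) \<le> c * (cmod z)\<^sup>2"
    using complex_Re_le_cmod[of "of_real c * \<omega> * z\<^sup>2"] assms by (simp add: norm_mult norm_power)
  then show "(cmod (exp (of_real c * \<omega> * z\<^sup>2)))\<^sup>2 \<le> 1 * exp (2 * c * (cmod z)\<^sup>2)"
    unfolding norm_exp_eq_Re exp_double[symmetric] by simp
qed (use assms in \<open>auto intro!: holomorphic_intros\<close>)

text \<open>The larger of \<open>\<bar>Re z\<bar>\<close> and \<open>\<bar>Im z\<bar>\<close> is at least \<open>\<bar>z\<bar> / sqrt 2\<close>, and \<open>7 / 10 < 1 / sqrt 2\<close>.\<close>

lemma dominant_axis_direction: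
  obtains \<omega> where "\<omega> \<in> {1, -1, \<i>, -\<i>}" "7 / 10 * cmod z \<le> Re (\<omega> * z)"
proof -
  have "(7 / 10 * cmod z)\<^sup>2 \<le> (max \<bar>Re z\<bar> \<bar>Im z\<bar>)\<^sup>2"
  proof -
    have "(Re z)\<^sup>2 \<le> (max \<bar>Re z\<bar> \<bar>Im z\<bar>)\<^sup>2" "(Im z)\<^sup>2 \<le> (max \<bar>Re z\<bar> \<bar>Im z\<bar>)\<^sup>2"
      by (simp_all flip: abs_le_square_iff)
    moreover have "(7 / 10 * cmod z)\<^sup>2 = 49 / 100 * ((Re z)\<^sup>2 + (Im z)\<^sup>2)"
      unfolding power_mult_distrib cmod_power2 by (simp add: power_divide)
    moreover have "49 / 100 * (x + y) \<le> m\<^sup>2" if "x \<le> m\<^sup>2" "y \<le> m\<^sup>2" for x y m :: real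
    proof -
      have "49 / 100 * (x + y) \<le> 49 / 100 * (m\<^sup>2 + m\<^sup>2)"
        using that by (intro mult_left_mono add_mono) auto
      also have "\<dots> \<le> m\<^sup>2" by simp
      finally show ?thesis .
    qed
    ultimately show ?thesis by metis
  qed
  then have "7 / 10 * cmod z \<le> max \<bar>Re z\<bar> \<bar>Im z\<bar>"
    by (rule power2_le_imp_le) auto
  then consider "7 / 10 * cmod z \<le> Re z" | "7 / 10 * cmod z \<le> - Re z"
    | "7 / 10 * cmod z \<le> Im z" | "7 / 10 * cmod z \<le> - Im z"
    by (auto simp: max_def abs_if split: if_splits)
  then show thesis
    by cases (use that[of 1] that[of "-1"] that[of "-\<i>"] that[of \<i>] in auto)
qed

context fock_sampling
begin

text \<open>This says that \<open>exp (- t * \<bar>\<gamma>\<bar>\<^sup>2)\<close> with \<open>t = 67 / 200 * \<alpha>\<close> is summable over \<open>\<Gamma>\<close>. The four functions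
  \<open>exp (c * \<omega> * z\<^sup>2)\<close>, with \<open>\<omega>\<close> a fourth root of unity and \<open>2 * c = 19 / 20 * \<alpha> < \<alpha>\<close>, belong to the space
  and together dominate \<open>exp (7 / 10 * 2 * c * \<bar>z\<bar>\<^sup>2)\<close>, which is where \<open>133 / 200\<close> comes from. The
  exponent matters: since \<open>133 / 200 > 1 / 2\<close>, functions bounded on \<open>\<Gamma>\<close> will turn out to have
  squares in the space.\<close>

lemma gaussian_samples_bounded:
  obtains C where "\<And>S. finite S \<Longrightarrow> S \<subseteq> \<Gamma> \<Longrightarrow>
    (\<Sum>\<gamma>\<in>S. exp (133 / 200 * \<alpha> * (cmod \<gamma>)\<^sup>2) * fock_weight \<alpha> \<gamma>) \<le> C"
proof -
  let ?W = "{1, -1, \<i>, -\<i>}"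
  define E where "E \<omega> z = exp (of_real (19 / 40 * \<alpha>) * \<omega> * z\<^sup>2)" for \<omega> z :: complex
  have E: "E \<omega> \<in> fock_space \<alpha>" if "\<omega> \<in> ?W" for \<omega>
    unfolding E_def[abs_def] using that alpha by (intro exp_quadratic_in_fock_space) auto
  have pt: "exp (133 / 200 * \<alpha> * (cmod z)\<^sup>2) \<le> (\<Sum>\<omega>\<in>?W. (cmod (E \<omega> z))\<^sup>2)" for z
  proof -
    obtain \<omega> where \<omega>: "\<omega> \<in> ?W" "7 / 10 * cmod (z\<^sup>2) \<le> Re (\<omega> * z\<^sup>2)"
      by (rule dominant_axis_direction)
    have "2 * (19 / 40 * \<alpha>) * (7 / 10 * cmod (z\<^sup>2)) \<le> 2 * (19 / 40 * \<alpha>) * Re (\<omega> * z\<^sup>2)"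
      using \<omega>(2) alpha by (intro mult_left_mono) auto
    then have "exp (133 / 200 * \<alpha> * (cmod z)\<^sup>2) \<le> exp (2 * Re (of_real (19 / 40 * \<alpha>) * (\<omega> * z\<^sup>2)))"
      by (simp add: norm_power Re_complex_of_real algebra_simps)
    also have "\<dots> = (cmod (E \<omega> z))\<^sup>2"
      by (simp only: E_def norm_exp_eq_Re exp_double mult.assoc)
    also have "\<dots> \<le> (\<Sum>\<omega>\<in>?W. (cmod (E \<omega> z))\<^sup>2)"
      using \<omega>(1) by (intro member_le_sum) auto
    finally show ?thesis .
  qed
  show thesis
  proof (rule that)
    fix S assume S: "finite S" "S \<subseteq> \<Gamma>"
    have "(\<Sum>\<gamma>\<in>S. exp (133 / 200 * \<alpha> * (cmod \<gamma>)\<^sup>2) * fock_weight \<alpha> \<gamma>)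
        \<le> (\<Sum>\<gamma>\<in>S. (\<Sum>\<omega>\<in>?W. (cmod (E \<omega> \<gamma>))\<^sup>2) * fock_weight \<alpha> \<gamma>)"
      by (intro sum_mono mult_right_mono pt less_imp_le fock_weight_pos)
    also have "\<dots> = (\<Sum>\<omega>\<in>?W. \<Sum>\<gamma>\<in>S. (cmod (E \<omega> \<gamma>))\<^sup>2 * fock_weight \<alpha> \<gamma>)"
      unfolding sum_distrib_right by (rule sum.swap)
    also have "\<dots> \<le> (\<Sum>\<omega>\<in>?W. b * fock_energy \<alpha> (E \<omega>))"
      by (intro sum_mono upper E S)
    finally show "(\<Sum>\<gamma>\<in>S. exp (133 / 200 * \<alpha> * (cmod \<gamma>)\<^sup>2) * fock_weight \<alpha> \<gamma>)
        \<le> (\<Sum>\<omega>\<in>?W. b * fock_energy \<alpha> (E \<omega>))" .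
  qed
qed

text \<open>Membership is an induction on \<open>n\<close>: the samples of \<open>z ^ n * F\<close> are those of a polynomial up to
  a bounded factor, so they are square summable for every \<open>n\<close>. The factor \<open>fact n / s ^ n\<close>
  comes from \<open>(s * x) ^ n / fact n \<le> exp (s * x)\<close>.\<close>

lemma powers_times_bounded:
  assumes F: "F \<in> fock_space \<alpha>" and M: "\<And>\<gamma>. \<gamma> \<in> \<Gamma> \<Longrightarrow> cmod (F \<gamma>) \<le> M"
  obtains D where "\<And>n. (\<lambda>z. z ^ n * F z) \<in> fock_space \<alpha>"
    and "\<And>n. fock_energy \<alpha> (\<lambda>z. z ^ n * F z) \<le> D * (fact n / (133 / 200 * \<alpha>) ^ n)"
proof -
  obtain C where C: "\<And>S. finite S \<Longrightarrow> S \<subseteq> \<Gamma> \<Longrightarrow>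
    (\<Sum>\<gamma>\<in>S. exp (133 / 200 * \<alpha> * (cmod \<gamma>)\<^sup>2) * fock_weight \<alpha> \<gamma>) \<le> C"
    using gaussian_samples_bounded by blast
  let ?s = "133 / 200 * \<alpha>"
  have s: "?s > 0" using alpha by simp
  have sums: "(\<Sum>\<gamma>\<in>S. (cmod (\<gamma> ^ n * F \<gamma>))\<^sup>2 * fock_weight \<alpha> \<gamma>) \<le> M\<^sup>2 * C * (fact n / ?s ^ n)"
    if S: "finite S" "S \<subseteq> \<Gamma>" for S n
  proof -
    have "(cmod (\<gamma> ^ n * F \<gamma>))\<^sup>2 * fock_weight \<alpha> \<gamma>
        \<le> (M\<^sup>2 * (fact n / ?s ^ n)) * (exp (?s * (cmod \<gamma>)\<^sup>2) * fock_weight \<alpha> \<gamma>)" if "\<gamma> \<in> S" for \<gamma>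
    proof -
      have "(?s * (cmod \<gamma>)\<^sup>2) ^ n / fact n \<le> exp (?s * (cmod \<gamma>)\<^sup>2)"
        using s by (intro power_div_fact_le_exp) auto
      then have "((cmod \<gamma>)\<^sup>2) ^ n \<le> fact n / ?s ^ n * exp (?s * (cmod \<gamma>)\<^sup>2)"
        using s by (simp add: power_mult_distrib field_simps)
      moreover have "(cmod (F \<gamma>))\<^sup>2 \<le> M\<^sup>2"
        using M[of \<gamma>] that S by (intro power_mono) auto
      ultimately have "((cmod \<gamma>)\<^sup>2) ^ n * (cmod (F \<gamma>))\<^sup>2 \<le> (fact n / ?s ^ n * exp (?s * (cmod \<gamma>)\<^sup>2)) * M\<^sup>2"
        using s by (intro mult_mono) auto
      then have "((cmod \<gamma>)\<^sup>2) ^ n * (cmod (F \<gamma>))\<^sup>2 * fock_weight \<alpha> \<gamma>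
          \<le> (fact n / ?s ^ n * exp (?s * (cmod \<gamma>)\<^sup>2)) * M\<^sup>2 * fock_weight \<alpha> \<gamma>"
        by (rule mult_right_mono) (simp add: fock_weight_def)
      then show ?thesis
        by (simp add: norm_mult norm_power power_mult_distrib power_even_eq mult_ac power_mult[symmetric])
    qed
    then have "(\<Sum>\<gamma>\<in>S. (cmod (\<gamma> ^ n * F \<gamma>))\<^sup>2 * fock_weight \<alpha> \<gamma>)
        \<le> (M\<^sup>2 * (fact n / ?s ^ n)) * (\<Sum>\<gamma>\<in>S. exp (?s * (cmod \<gamma>)\<^sup>2) * fock_weight \<alpha> \<gamma>)"
      unfolding sum_distrib_left by (rule sum_mono)
    also have "\<dots> \<le> (M\<^sup>2 * (fact n / ?s ^ n)) * C"
      using s by (intro mult_left_mono C S) auto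
    finally show ?thesis by (simp add: mult_ac)
  qed
  have mem: "(\<lambda>z. z ^ n * F z) \<in> fock_space \<alpha>" for n
  proof (induction n)
    case (Suc n)
    have "(\<lambda>z. z * (z ^ n * F z)) \<in> fock_space \<alpha>"
    proof (rule mult_id_in_fock_space[OF Suc])
      fix S assume "finite S" "S \<subseteq> \<Gamma>"
      from sums[OF this, of "Suc n"]
      show "(\<Sum>\<gamma>\<in>S. (cmod \<gamma>)\<^sup>2 * ((cmod (\<gamma> ^ n * F \<gamma>))\<^sup>2 * fock_weight \<alpha> \<gamma>))
          \<le> M\<^sup>2 * C * (fact (Suc n) / ?s ^ Suc n)"
        by (simp only: power_Suc mult.assoc norm_mult power_mult_distrib)
    qed
    then show ?case by (simp add: mult.assoc)
  qed (use F in simp)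
  have "fock_energy \<alpha> (\<lambda>z. z ^ n * F z) \<le> M\<^sup>2 * C / a * (fact n / ?s ^ n)" for n
    using energy_le_of_sums[OF mem[of n] sums] by (simp add: mult_ac)
  with mem show thesis by (rule that)
qed

text \<open>Point evaluation at \<open>w\<close> of \<open>z ^ n * F\<close>, multiplied by \<open>(3 / 5 * \<alpha>) ^ n / fact n\<close>, is bounded by a
  geometric sequence because \<open>3 / 5 < 133 / 200\<close>; summation over \<open>n\<close> turns the left-hand side into
  \<open>\<bar>F w\<bar>\<^sup>2 * exp (- 2 / 5 * \<alpha> * \<bar>w\<bar>\<^sup>2)\<close>. Any exponent below \<open>\<alpha> / 2\<close> would do.\<close>

lemma bounded_on_samples_growth:
  assumes F: "F \<in> fock_space \<alpha>" and M: "\<And>\<gamma>. \<gamma> \<in> \<Gamma> \<Longrightarrow> cmod (F \<gamma>) \<le> M"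
  obtains C where "\<And>w. (cmod (F w))\<^sup>2 \<le> C * exp (2 / 5 * \<alpha> * (cmod w)\<^sup>2)"
proof -
  let ?s = "133 / 200 * \<alpha>"
  obtain D where mem: "\<And>n. (\<lambda>z. z ^ n * F z) \<in> fock_space \<alpha>"
    and D: "\<And>n. fock_energy \<alpha> (\<lambda>z. z ^ n * F z) \<le> D * (fact n / ?s ^ n)"
    using powers_times_bounded[OF F M] by blast
  have "(cmod (F w))\<^sup>2 \<le> b * D * (133 / 13) * exp (2 / 5 * \<alpha> * (cmod w)\<^sup>2)" for w
  proof -
    let ?c = "(cmod (F w))\<^sup>2 * fock_weight \<alpha> w" and ?x = "3 / 5 * \<alpha> * (cmod w)\<^sup>2"
    have coefficient: "?x ^ n / fact n * ?c \<le> (120 / 133) ^ n * (b * D)" for n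
    proof -
      have "((cmod w)\<^sup>2) ^ n * ?c \<le> b * fock_energy \<alpha> (\<lambda>z. z ^ n * F z)"
        using pointwise_bound[OF mem[of n], of w]
        by (simp add: norm_mult norm_power power_mult_distrib mult.assoc power_mult[symmetric] mult.commute[of 2])
      also have "\<dots> \<le> b * (D * (fact n / ?s ^ n))"
        using D[of n] b by (intro mult_left_mono) auto
      finally have le: "((cmod w)\<^sup>2) ^ n * ?c \<le> b * (D * (fact n / ?s ^ n))" .
      have "?x ^ n / fact n * ?c = (3 / 5 * \<alpha>) ^ n / fact n * (((cmod w)\<^sup>2) ^ n * ?c)"
        unfolding power_mult_distrib[of "3 / 5 * \<alpha>"] by simp
      also have "\<dots> \<le> (3 / 5 * \<alpha>) ^ n / fact n * (b * (D * (fact n / ?s ^ n)))"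
        using alpha by (intro mult_left_mono le) auto
      also have "\<dots> = ((3 / 5 * \<alpha>) ^ n / ?s ^ n) * (b * D)" by simp
      also have "(3 / 5 * \<alpha>) ^ n / ?s ^ n = (120 / 133) ^ n"
        using alpha by (simp add: power_divide[symmetric])
      finally show ?thesis .
    qed
    have s1: "(\<lambda>n. ?x ^ n / fact n * ?c) sums (exp ?x * ?c)"
      by (rule sums_mult2[OF exp_power_series])
    have s2: "(\<lambda>n. (120 / 133) ^ n * (b * D)) sums (1 / (1 - 120 / 133) * (b * D))"
      by (intro sums_mult2 geometric_sums) auto
    have "exp ?x * ?c \<le> 133 / 13 * (b * D)"
      using sums_le[OF coefficient s1 s2] by simp
    then have "exp (2 / 5 * \<alpha> * (cmod w)\<^sup>2) * (exp ?x * ?c)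
        \<le> exp (2 / 5 * \<alpha> * (cmod w)\<^sup>2) * (133 / 13 * (b * D))"
      by (rule mult_left_mono) simp
    moreover have "exp (2 / 5 * \<alpha> * (cmod w)\<^sup>2) * (exp ?x * ?c) = (cmod (F w))\<^sup>2"
    proof -
      have one: "exp (2 / 5 * \<alpha> * (cmod w)\<^sup>2) * (exp ?x * fock_weight \<alpha> w) = 1"
        unfolding fock_weight_def exp_add[symmetric] by (simp add: field_simps)
      have "exp (2 / 5 * \<alpha> * (cmod w)\<^sup>2) * (exp ?x * ?c)
          = (cmod (F w))\<^sup>2 * (exp (2 / 5 * \<alpha> * (cmod w)\<^sup>2) * (exp ?x * fock_weight \<alpha> w))"
        by (simp only: mult_ac)
      then show ?thesis by (simp only: one mult_1_right)
    qed
    ultimately have "(cmod (F w))\<^sup>2 \<le> exp (2 / 5 * \<alpha> * (cmod w)\<^sup>2) * (133 / 13 * (b * D))"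
      by (simp only:)
    then show ?thesis by (simp only: mult_ac)
  qed
  then show thesis by (rule that)
qed

text \<open>Squaring doubles the exponent \<open>2 / 5 * \<alpha>\<close> to \<open>4 / 5 * \<alpha> < \<alpha>\<close> and preserves boundedness on
  \<open>\<Gamma>\<close>, so the growth bound applies anew to each square.\<close>

lemma iterated_squares_in_fock_space:
  assumes F: "F \<in> fock_space \<alpha>" and M: "\<And>\<gamma>. \<gamma> \<in> \<Gamma> \<Longrightarrow> cmod (F \<gamma>) \<le> M"
  shows "(\<lambda>z. F z ^ 2 ^ k) \<in> fock_space \<alpha>"
proof (induction k)
  case (Suc k)
  have "cmod (F \<gamma> ^ 2 ^ k) \<le> M ^ 2 ^ k" if "\<gamma> \<in> \<Gamma>" for \<gamma>
    using M[OF that] by (simp add: norm_power power_mono)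
  then obtain C where C: "\<And>w. (cmod (F w ^ 2 ^ k))\<^sup>2 \<le> C * exp (2 / 5 * \<alpha> * (cmod w)\<^sup>2)"
    using bounded_on_samples_growth[OF Suc] by blast
  show ?case
  proof (rule fock_space_growthI[where t = "4 / 5 * \<alpha>" and C = "C\<^sup>2"])
    show "(\<lambda>z. F z ^ 2 ^ Suc k) holomorphic_on UNIV"
      using fock_space_holomorphic[OF F] by (intro holomorphic_intros)
    fix z
    have "(cmod (F z ^ 2 ^ Suc k))\<^sup>2 = ((cmod (F z ^ 2 ^ k))\<^sup>2)\<^sup>2"
      by (simp add: norm_power power_mult[symmetric] mult_ac)
    also have "\<dots> \<le> (C * exp (2 / 5 * \<alpha> * (cmod z)\<^sup>2))\<^sup>2"
      by (intro power_mono C) auto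
    also have "\<dots> = C\<^sup>2 * exp (4 / 5 * \<alpha> * (cmod z)\<^sup>2)"
      by (simp add: power_mult_distrib exp_double[symmetric])
    finally show "(cmod (F z ^ 2 ^ Suc k))\<^sup>2 \<le> C\<^sup>2 * exp (4 / 5 * \<alpha> * (cmod z)\<^sup>2)" .
  qed (use alpha in auto)
qed (use F in simp)

section \<open>Sampling sets are Liouville sets\<close>

text \<open>The sampling inequalities for the powers \<open>F ^ 2 ^ k\<close> bound the powers of \<open>\<bar>F w\<bar> / M\<close> by a constant
  that is independent of \<open>k\<close>, so this ratio cannot exceed 1.\<close>

lemma bounded_by_sample_bound:
  assumes F: "F \<in> fock_space \<alpha>" and M: "\<And>\<gamma>. \<gamma> \<in> \<Gamma> \<Longrightarrow> cmod (F \<gamma>) \<le> M" and M0: "M > 0"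
  shows "cmod (F w) \<le> M"
proof (rule ccontr)
  assume "\<not> cmod (F w) \<le> M"
  then have r: "cmod (F w) / M > 1" using M0 by simp
  define D where "D = b * (b * fock_energy \<alpha> (\<lambda>z. 1) / a) / fock_weight \<alpha> w"
  have le: "(cmod (F w) / M) ^ (2 * 2 ^ k) \<le> D" for k
  proof -
    let ?G = "\<lambda>z. F z ^ 2 ^ k"
    have G: "?G \<in> fock_space \<alpha>" by (rule iterated_squares_in_fock_space[OF F M])
    have "(\<Sum>\<gamma>\<in>S. (cmod (?G \<gamma>))\<^sup>2 * fock_weight \<alpha> \<gamma>) \<le> M ^ (2 * 2 ^ k) * (b * fock_energy \<alpha> (\<lambda>z. 1))"
      if S: "finite S" "S \<subseteq> \<Gamma>" for S
    proof -
      have "(cmod (?G \<gamma>))\<^sup>2 \<le> M ^ (2 * 2 ^ k)" if "\<gamma> \<in> S" for \<gamma>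
        using M[of \<gamma>] that S
        by (auto simp: norm_power power_mult[symmetric] mult.commute[of 2] intro!: power_mono)
      then have "(\<Sum>\<gamma>\<in>S. (cmod (?G \<gamma>))\<^sup>2 * fock_weight \<alpha> \<gamma>) \<le> (\<Sum>\<gamma>\<in>S. M ^ (2 * 2 ^ k) * fock_weight \<alpha> \<gamma>)"
        by (intro sum_mono mult_right_mono) (auto simp: fock_weight_def)
      also have "\<dots> = M ^ (2 * 2 ^ k) * (\<Sum>\<gamma>\<in>S. (cmod 1)\<^sup>2 * fock_weight \<alpha> \<gamma>)"
        by (simp add: sum_distrib_left)
      also have "\<dots> \<le> M ^ (2 * 2 ^ k) * (b * fock_energy \<alpha> (\<lambda>z. 1))"
        using M0 by (intro mult_left_mono upper[OF one_in_fock_space[OF alpha]] S) auto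
      finally show ?thesis .
    qed
    then have "fock_energy \<alpha> ?G \<le> M ^ (2 * 2 ^ k) * (b * fock_energy \<alpha> (\<lambda>z. 1)) / a"
      by (rule energy_le_of_sums[OF G])
    then have "b * fock_energy \<alpha> ?G \<le> b * (M ^ (2 * 2 ^ k) * (b * fock_energy \<alpha> (\<lambda>z. 1)) / a)"
      using b by (intro mult_left_mono) auto
    with pointwise_bound[OF G, of w]
    have le: "(cmod (?G w))\<^sup>2 * fock_weight \<alpha> w \<le> b * (M ^ (2 * 2 ^ k) * (b * fock_energy \<alpha> (\<lambda>z. 1)) / a)"
      by linarith
    have "(cmod (F w)) ^ (2 * 2 ^ k) \<le> D * M ^ (2 * 2 ^ k)"
    proof -
      have "(cmod (?G w))\<^sup>2 = cmod (F w) ^ (2 * 2 ^ k)"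
        by (simp add: norm_power power_mult[symmetric] mult.commute[of 2])
      with le show ?thesis
        unfolding D_def pos_le_divide_eq[OF fock_weight_pos, symmetric] by (simp add: mult_ac)
    qed
    then show ?thesis using M0 by (simp add: power_divide field_simps)
  qed
  obtain n where "D < (cmod (F w) / M) ^ n" using real_arch_pow[OF r] by blast
  also have "\<dots> \<le> (cmod (F w) / M) ^ (2 * 2 ^ n)"
  proof (rule power_increasing)
    show "n \<le> 2 * 2 ^ n" using less_exp[of n] by linarith
  qed (use r in simp)
  finally show False using le[of n] by simp
qed

lemma liouville: "liouville_set \<alpha> \<Gamma>"
  unfolding liouville_set_def
proof (intro ballI impI)
  fix F assume F: "F \<in> fock_space \<alpha>" and "bounded (F ` \<Gamma>)"
  then obtain M where "M > 0" and "\<And>\<gamma>. \<gamma> \<in> \<Gamma> \<Longrightarrow> cmod (F \<gamma>) \<le> M"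
    by (auto simp: bounded_pos)
  then have "cmod (F w) \<le> M" for w
    using bounded_by_sample_bound[OF F] by blast
  then have "bounded (range F)" by (auto simp: bounded_iff)
  with fock_space_holomorphic[OF F] show "F constant_on UNIV" by (rule Liouville_theorem)
qed

section \<open>Liouville sets with large holes\<close>

text \<open>The test functions are the translates to \<open>w\<close> of the constant 1 and of the identity. If \<open>\<Gamma>\<close> avoids the
  disc of radius \<open>R\<close> about \<open>w\<close>, then every sample of the second is at least \<open>R\<close> times the one of the
  first, whereas the two norms have a ratio that does not depend on \<open>w\<close>.\<close>

lemma relatively_dense:
  obtains R where "\<And>w. \<exists>\<gamma>\<in>\<Gamma>. cmod (\<gamma> - w) < R"
proof -
  let ?e1 = "fock_energy \<alpha> (\<lambda>z. 1)" and ?e2 = "fock_energy \<alpha> (\<lambda>z. z)"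
  note e1 = fock_energy_one_pos[OF alpha]
  note one = one_in_fock_space[OF alpha] and idf = id_in_fock_space[OF alpha]
  define R where "R = sqrt (b * ?e2 / (a * ?e1)) + 1"
  have pos: "b * ?e2 / (a * ?e1) \<ge> 0" using a b e1 fock_energy_nonneg[of \<alpha> "\<lambda>z. z"] by simp
  then have R1: "R > 0" by (simp add: R_def add_nonneg_pos)
  have "(sqrt (b * ?e2 / (a * ?e1)))\<^sup>2 < R\<^sup>2"
    using pos by (intro power_strict_mono) (auto simp: R_def)
  then have R2: "b * ?e2 < R\<^sup>2 * (a * ?e1)" using pos a e1 by (simp add: field_simps)
  have "\<exists>\<gamma>\<in>\<Gamma>. cmod (\<gamma> - w) < R" for w
  proof (rule ccontr)
    assume "\<not> (\<exists>\<gamma>\<in>\<Gamma>. cmod (\<gamma> - w) < R)"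
    then have far: "R \<le> cmod (\<gamma> - w)" if "\<gamma> \<in> \<Gamma>" for \<gamma> using that by force
    let ?x = "exp (\<alpha> * (cmod w)\<^sup>2)"
    have "(\<Sum>\<gamma>\<in>S. (cmod (twisted_shift \<alpha> w (\<lambda>z. 1) \<gamma>))\<^sup>2 * fock_weight \<alpha> \<gamma>) \<le> b * (?x * ?e2) / R\<^sup>2"
      if S: "finite S" "S \<subseteq> \<Gamma>" for S
    proof -
      have "R\<^sup>2 * ((cmod (twisted_shift \<alpha> w (\<lambda>z. 1) \<gamma>))\<^sup>2 * fock_weight \<alpha> \<gamma>)
        \<le> (cmod (twisted_shift \<alpha> w (\<lambda>z. z) \<gamma>))\<^sup>2 * fock_weight \<alpha> \<gamma>" if "\<gamma> \<in> S" for \<gamma>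
      proof -
        have "R\<^sup>2 \<le> (cmod (\<gamma> - w))\<^sup>2" using far[of \<gamma>] that S R1 by (intro power_mono) auto
        then have "R\<^sup>2 * (?x * fock_weight \<alpha> (\<gamma> - w)) \<le> (cmod (\<gamma> - w))\<^sup>2 * (?x * fock_weight \<alpha> (\<gamma> - w))"
          by (rule mult_right_mono) (simp add: fock_weight_def)
        then show ?thesis
          unfolding twisted_shift_weight by (simp add: mult_ac)
      qed
      then have "R\<^sup>2 * (\<Sum>\<gamma>\<in>S. (cmod (twisted_shift \<alpha> w (\<lambda>z. 1) \<gamma>))\<^sup>2 * fock_weight \<alpha> \<gamma>)
        \<le> (\<Sum>\<gamma>\<in>S. (cmod (twisted_shift \<alpha> w (\<lambda>z. z) \<gamma>))\<^sup>2 * fock_weight \<alpha> \<gamma>)"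
        unfolding sum_distrib_left by (rule sum_mono)
      also have "\<dots> \<le> b * (?x * ?e2)"
        using upper[OF twisted_shift_in_fock_space(1)[OF idf] S]
        by (simp add: twisted_shift_in_fock_space(2)[OF idf])
      finally show ?thesis using R1 by (simp add: field_simps)
    qed
    then have "a * (?x * ?e1) \<le> b * (?x * ?e2) / R\<^sup>2"
      using lower[OF twisted_shift_in_fock_space(1)[OF one]]
      by (simp add: twisted_shift_in_fock_space(2)[OF one])
    then have "?x * (R\<^sup>2 * (a * ?e1)) \<le> ?x * (b * ?e2)"
      using R1 by (simp add: field_simps)
    with R2 show False by simp
  qed
  then show thesis by (rule that)
qed

end

lemma liouville_set_mono: "liouville_set \<alpha> \<Gamma> \<Longrightarrow> \<Gamma> \<subseteq> \<Lambda> \<Longrightarrow> liouville_set \<alpha> \<Lambda>"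
  unfolding liouville_set_def by (meson bounded_subset image_mono)

definition square_circles :: "complex set" where
  "square_circles = {z. \<exists>n::nat. cmod z = (real n)\<^sup>2}"

lemma liouville_square_circles: "liouville_set \<alpha> square_circles"
  unfolding liouville_set_def
proof (intro ballI impI)
  fix F assume F: "F \<in> fock_space \<alpha>" and "bounded (F ` square_circles)"
  then obtain M where M: "\<And>z. z \<in> square_circles \<Longrightarrow> cmod (F z) \<le> M"
    by (auto simp: bounded_iff)
  have hol: "F holomorphic_on UNIV" by (rule fock_space_holomorphic[OF F])
  have "cmod (F w) \<le> M" for w
  proof -
    obtain n :: nat where n: "cmod w < real n" using reals_Archimedean2 by blast
    then have n0: "real n > 0" using norm_ge_zero[of w] by linarith
    then have "1 \<le> real n" by simp
    then have "real n \<le> (real n)\<^sup>2" by (simp add: power2_eq_square)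
    show ?thesis
    proof (rule maximum_modulus_frontier[of F "ball 0 ((real n)\<^sup>2)"])
      show "continuous_on (closure (ball 0 ((real n)\<^sup>2))) F"
        using hol by (meson holomorphic_on_imp_continuous_on continuous_on_subset subset_UNIV)
      show "w \<in> ball 0 ((real n)\<^sup>2)" using less_le_trans[OF n \<open>real n \<le> (real n)\<^sup>2\<close>] by (simp del: of_nat_power)
      fix z :: complex assume "z \<in> frontier (ball 0 ((real n)\<^sup>2))"
      then have "z \<in> square_circles" using n0 by (auto simp: square_circles_def)
      then show "cmod (F z) \<le> M" by (rule M)
    qed (use hol in \<open>auto intro: holomorphic_on_subset\<close>)
  qed
  then have "bounded (range F)" by (auto simp: bounded_iff)
  with hol show "F constant_on UNIV" by (rule Liouville_theorem)
qed

text \<open>The centre \<open>n\<^sup>2 + n\<close> lies between the circles of radii \<open>n\<^sup>2\<close> and \<open>n\<^sup>2 + 2 * n + 1\<close>.\<close>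

lemma square_circles_gap:
  assumes "\<gamma> \<in> square_circles"
  shows "real n \<le> cmod (\<gamma> - of_real ((real n)\<^sup>2 + real n))"
proof -
  obtain k where k: "cmod \<gamma> = (real k)\<^sup>2" using assms by (auto simp: square_circles_def)
  have "real n \<le> \<bar>(real k)\<^sup>2 - ((real n)\<^sup>2 + real n)\<bar>"
  proof (cases "k \<le> n")
    case True
    then have "(real k)\<^sup>2 \<le> (real n)\<^sup>2" by (intro power_mono) auto
    then show ?thesis by linarith
  next
    case False
    then have "(real n + 1)\<^sup>2 \<le> (real k)\<^sup>2" by (intro power_mono) auto
    then show ?thesis by (simp add: power2_eq_square algebra_simps)
  qed
  also have "\<dots> \<le> cmod (\<gamma> - of_real ((real n)\<^sup>2 + real n))"
    using norm_triangle_ineq3[of \<gamma> "of_real ((real n)\<^sup>2 + real n)"]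
    by (simp only: k norm_of_real) simp
  finally show ?thesis .
qed

lemma no_sampling_in_square_circles:
  assumes "\<alpha> > 0" "\<Gamma> \<subseteq> square_circles"
  shows "\<not> stable_sampling \<alpha> \<Gamma>"
proof
  assume "stable_sampling \<alpha> \<Gamma>"
  then obtain a b where "fock_sampling \<alpha> a b \<Gamma>"
    using stable_sampling_imp_fock_sampling[OF assms(1)] by blast
  then obtain R where R: "\<And>w. \<exists>\<gamma>\<in>\<Gamma>. cmod (\<gamma> - w) < R"
    using fock_sampling.relatively_dense by blast
  obtain n :: nat where n: "R < real n" using reals_Archimedean2 by blast
  obtain \<gamma> where "\<gamma> \<in> \<Gamma>" "cmod (\<gamma> - of_real ((real n)\<^sup>2 + real n)) < R" using R by blast
  with square_circles_gap[of \<gamma> n] assms(2) n show False by force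
qed

section \<open>Uniqueness sets and the strict inclusions\<close>

lemma id_not_constant: "\<not> (\<lambda>z::complex. z) constant_on UNIV"
  unfolding constant_on_def by (metis UNIV_I zero_neq_one)

lemma liouville_imp_uniqueness:
  assumes "\<alpha> > 0" "liouville_set \<alpha> \<Lambda>"
  shows "uniqueness_set \<alpha> \<Lambda>"
  unfolding uniqueness_set_def
proof (intro ballI impI)
  fix F assume F: "F \<in> fock_space \<alpha>" and zero: "\<forall>z\<in>\<Lambda>. F z = 0"
  have "\<Lambda> \<noteq> {}"
    using assms id_in_fock_space id_not_constant unfolding liouville_set_def by fastforce
  then obtain w where "w \<in> \<Lambda>" by blast
  have "bounded (F ` \<Lambda>)" using zero by (auto simp: bounded_iff)
  with F assms(2) have "F constant_on UNIV" by (auto simp: liouville_set_def)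
  then show "\<forall>z. F z = 0" using zero \<open>w \<in> \<Lambda>\<close> by (metis UNIV_I constant_on_def)
qed

lemma uniqueness_set_unit_disc: "uniqueness_set \<alpha> (ball 0 1)"
  unfolding uniqueness_set_def
proof (intro ballI impI allI)
  fix F z assume "F \<in> fock_space \<alpha>" "\<forall>z\<in>ball 0 1. F z = 0"
  then show "F z = 0"
    by (intro analytic_continuation_open[of "ball 0 1" UNIV F "\<lambda>_. 0" z])
      (auto simp: fock_space_holomorphic)
qed

lemma not_liouville_unit_disc:
  assumes "\<alpha> > 0"
  shows "\<not> liouville_set \<alpha> (ball 0 1)"
  using id_in_fock_space[OF assms] id_not_constant bounded_ball
  unfolding liouville_set_def by fastforce

theorem theorem2p5:
  fixes \<alpha> :: real
  assumes "\<alpha> > 0"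
  shows "sampling_supersets \<alpha> \<subset> liouville_sets \<alpha> \<and> liouville_sets \<alpha> \<subset> uniqueness_sets \<alpha>"
proof
  have sub: "liouville_set \<alpha> \<Lambda>" if subset: "\<Gamma> \<subseteq> \<Lambda>" and sampling: "stable_sampling \<alpha> \<Gamma>" for \<Gamma> \<Lambda>
  proof -
    obtain a b where "fock_sampling \<alpha> a b \<Gamma>"
      using stable_sampling_imp_fock_sampling[OF assms sampling] .
    then have "liouville_set \<alpha> \<Gamma>" by (rule fock_sampling.liouville)
    then show ?thesis using subset by (rule liouville_set_mono)
  qed
  have strict: "square_circles \<in> liouville_sets \<alpha> - sampling_supersets \<alpha>"
    using liouville_square_circles no_sampling_in_square_circles[OF assms]
    by (auto simp: liouville_sets_def sampling_supersets_def)
  have "sampling_supersets \<alpha> \<subseteq> liouville_sets \<alpha>"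
    using sub by (auto simp: liouville_sets_def sampling_supersets_def)
  with strict show "sampling_supersets \<alpha> \<subset> liouville_sets \<alpha>" by blast
  have "ball 0 1 \<in> uniqueness_sets \<alpha> - liouville_sets \<alpha>"
    using uniqueness_set_unit_disc not_liouville_unit_disc[OF assms]
    by (auto simp: liouville_sets_def uniqueness_sets_def)
  then show "liouville_sets \<alpha> \<subset> uniqueness_sets \<alpha>"
    using liouville_imp_uniqueness[OF assms]
    by (auto simp: liouville_sets_def uniqueness_sets_def)
qed

end
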